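(* Let $S$ be a topological semigroup acting on a completely regular space $X$ endowed with an admissible family of open coverings $\mathcal{O}$, let $A\subset S$, and assume that $K_{A}(y)$ and $D_{A}(y)$ are nonempty and compact for every $y\in X$. Let $x\in X$. If $K_{A}$ is upper semicontinuous at $x$ then $K_{A}(x)=D_{A}(x)$. The converse holds if $X$ is Hausdorff locally compact and $A$ is connected.
   Context: For coverings $\mathcal{U},\mathcal{V}$ of $X$, $\mathcal{V}\leqslant\frac12\mathcal{U}$ means: for all $V,V'\in\mathcal{V}$ with $V\cap V'\neq\emptyset$ there is $U\in\mathcal{U}$ with $V\cup V'\subset U$. Star: $\mathrm{St}[x,\mathcal{U}]=\bigcup\{U\in\mathcal{U}: x\in U\}$. A family $\mathcal{O}$ of open coverings of $X$ is admissible if (1) for any $\mathcal{U},\mathcal{V}\in\mathcal{O}$ there is $\mathcal{W}\in\mathcal{O}$ with $\mathcal{W}\leqslant\frac12\mathcal{U}$ and $\mathcal{W}\leqslant\frac12\mathcal{V}$; and (2) the stars $\mathrm{St}[x,\mathcal{U}]$, $x\in X$, $\mathcal{U}\in\mathcal{O}$, form a basis for the topology of $X$. An action of $S$ on $X$ is a continuous map $S\times X\to X$, $(s,x)\mapsto sx$, with $s(tx)=(st)x$. For $A\subset S$, $Y\subset X$: $AY=\{sy:s\in A,y\in Y\}$, $Ax=A\{x\}$. Define $K_{A}(x)=\mathrm{cls}(Ax)$ and $D_{A}(x)=\bigcap_{\mathcal{U}\in\mathcal{O}}\mathrm{cls}(A\,\mathrm{St}[x,\mathcal{U}])$. A function $F$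 from $X$ to the set $\mathcal{H}(X)$ of nonempty closed subsets of $X$ is upper semicontinuous at $x$ if for every open $V\subset X$ with $F(x)\subset V$ there is a neighborhood $U$ of $x$ such that $F(y)\subset V$ for every $y\in U$.
   Formalization: "The stars form a basis for the topology" is taken pointwise: for each open G and x in G some U in O has St[x,U] contained in G. If the stars only form a basis as a family, with small stars around x possibly centred elsewhere, the first implication is false. *)

theory Defs
  imports "HOL-Analysis.Analysis"
begin

definition open_covering :: "'x::topological_space set set \<Rightarrow> bool" where
  "open_covering \<U> \<longleftrightarrow> (\<forall>U\<in>\<U>. open U) \<and> \<Union>\<U> = UNIV"

definition half_refines :: "'x set set \<Rightarrow> 'x set set \<Rightarrow> bool" where
  "half_refines \<V> \<U> \<longleftrightarrow>
     (\<forall>V\<in>\<V>. \<forall>V'\<in>\<V>. V \<inter> V' \<noteq> {} \<longrightarrow> (\<exists>U\<in>\<U>. V \<union> V' \<subseteq> U))"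

definition St :: "'x \<Rightarrow> 'x set set \<Rightarrow> 'x set" where
  "St x \<U> = \<Union>{U \<in> \<U>. x \<in> U}"

text \<open>
  "The stars form a basis for the topology" is read pointwise: the stars centred at a point
  \<open>x\<close> form a base of (open) neighbourhoods of \<open>x\<close>. As stars of open coverings are open, this
  implies that the family of all stars is a topological basis (lemma
  \<open>admissible_imp_topological_basis\<close> below). The converse fails: an open set containing \<open>x\<close>
  may contain a star centred at another point which contains \<open>x\<close>, but no star centred at \<open>x\<close>.
  For instance, let \<open>X\<close> consist of isolated points \<open>a k\<close>, \<open>b k\<close> and a limit \<open>p\<close> of the
  \<open>a k\<close>, with the \<open>b k\<close> forming a closed discrete set, and take the coverings (for all \<open>n\<close>)
  by \<open>{p} \<union> {a k | k. k \<ge> n}\<close>, \<open>{p} \<union> {a k | k. k > n} \<union> {b k | k. k \<ge> n}\<close> and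
  the singletons of \<open>a k\<close> and \<open>b k\<close> for \<open>k < n\<close>. Here every star centred at \<open>p\<close> contains almost
  all \<open>b k\<close>, and the sets \<open>D act \<O> A p\<close> below need not be related to the topology at \<open>p\<close>.
\<close>

definition admissible :: "'x::topological_space set set set \<Rightarrow> bool" where
  "admissible \<O> \<longleftrightarrow>
     (\<forall>\<U>\<in>\<O>. open_covering \<U>) \<and>
     (\<forall>\<U>\<in>\<O>. \<forall>\<V>\<in>\<O>. \<exists>\<W>\<in>\<O>. half_refines \<W> \<U> \<and> half_refines \<W> \<V>) \<and>
     (\<forall>x G. open G \<longrightarrow> x \<in> G \<longrightarrow> (\<exists>\<U>\<in>\<O>. St x \<U> \<subseteq> G))"

lemma open_St: "open_covering \<U> \<Longrightarrow> open (St x \<U>)"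
  by (auto simp: open_covering_def St_def)

lemma mem_St: "open_covering \<U> \<Longrightarrow> x \<in> St x \<U>"
  by (auto simp: open_covering_def St_def)

lemma admissible_imp_topological_basis:
  assumes "admissible \<O>"
  shows "topological_basis {St x \<U> | x \<U>. \<U> \<in> \<O>}"
proof (rule topological_basisI)
  fix B assume "B \<in> {St x \<U> | x \<U>. \<U> \<in> \<O>}"
  then show "open B"
    using assms by (auto simp: admissible_def open_St)
next
  fix G :: "'a set" and x assume "open G" "x \<in> G"
  then obtain \<U> where "\<U> \<in> \<O>" "St x \<U> \<subseteq> G"
    using assms unfolding admissible_def by blast
  moreover have "x \<in> St x \<U>"
    using assms \<open>\<U> \<in> \<O>\<close> by (auto simp: admissible_def mem_St)
  ultimately show "\<exists>B\<in>{St x \<U> | x \<U>. \<U> \<in> \<O>}. x \<in> B \<and> B \<subseteq> G"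
    by blast
qed

definition semigroup_action ::
    "('s::topological_semigroup_mult \<Rightarrow> 'x::topological_space \<Rightarrow> 'x) \<Rightarrow> bool" where
  "semigroup_action act \<longleftrightarrow>
     continuous_on UNIV (\<lambda>(s, x). act s x) \<and>
     (\<forall>s t x. act s (act t x) = act (s * t) x)"

definition act_set :: "('s \<Rightarrow> 'x \<Rightarrow> 'x) \<Rightarrow> 's set \<Rightarrow> 'x set \<Rightarrow> 'x set" where
  "act_set act A Y = {act s y | s y. s \<in> A \<and> y \<in> Y}"

definition K :: "('s \<Rightarrow> 'x::topological_space \<Rightarrow> 'x) \<Rightarrow> 's set \<Rightarrow> 'x \<Rightarrow> 'x set" where
  "K act A x = closure (act_set act A {x})"

definition D :: "('s \<Rightarrow> 'x::topological_space \<Rightarrow> 'x) \<Rightarrow> 'x set set set \<Rightarrow> 's set \<Rightarrow> 'x \<Rightarrow> 'x set" where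
  "D act \<O> A x = (\<Inter>\<U>\<in>\<O>. closure (act_set act A (St x \<U>)))"

definition upper_semicontinuous_at ::
    "('x::topological_space \<Rightarrow> 'x set) \<Rightarrow> 'x \<Rightarrow> bool" where
  "upper_semicontinuous_at F x \<longleftrightarrow>
     (\<forall>V. open V \<longrightarrow> F x \<subseteq> V \<longrightarrow> (\<forall>\<^sub>F y in nhds x. F y \<subseteq> V))"

end

theory Submission
  imports Defs
begin

text \<open>
  The inclusion \<open>K \<subseteq> D\<close> always holds, so only the reverse one needs upper semicontinuity.
  If \<open>z \<notin> K(x)\<close>, regularity puts disjoint open sets around \<open>K(x)\<close> and \<open>z\<close>; upper
  semicontinuity keeps the orbits of all points of some star at \<open>x\<close> inside the first of them,
  hence \<open>z\<close> is not in the closure of the orbit of that star, and \<open>z \<notin> D(x)\<close>.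

  For the converse, suppose \<open>K(x) = D(x) \<subseteq> V\<close>, and shrink \<open>V\<close> to an open set \<open>G \<supseteq> K(x)\<close> whose
  closure is compact and lies in \<open>V\<close>. Fix \<open>a \<in> A\<close>. For \<open>y\<close> close to \<open>x\<close> the point \<open>a y\<close> lies in
  \<open>G\<close>, so the connected set \<open>A y\<close> cannot leave \<open>G\<close> without crossing the compact frontier of \<open>G\<close>.
  If orbits starting in arbitrarily small stars at \<open>x\<close> left \<open>G\<close>, then the frontier would meet
  every set \<open>cls (A St[x, \<U>])\<close>. The stars at \<open>x\<close> are downward directed, so compactness
  (\<open>compact_Int_directed_closed\<close>) would produce a frontier point in \<open>D(x) \<subseteq> G\<close>, although an open
  set contains none of its frontier points. Hence some star at \<open>x\<close> has its orbits in \<open>G\<close>, and the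
  closures of these orbits lie in \<open>V\<close>.
\<close>

text \<open>
  A finite subcover of \<open>C\<close> by complements of members of the family is absorbed, by directedness,
  into the complement of a single member.
\<close>

lemma compact_Int_directed_closed:
  fixes F :: "'i \<Rightarrow> 'a::topological_space set"
  assumes C: "compact C" and "I \<noteq> {}"
    and closed: "\<And>i. i \<in> I \<Longrightarrow> closed (F i)"
    and meets: "\<And>i. i \<in> I \<Longrightarrow> C \<inter> F i \<noteq> {}"
    and directed: "\<And>i j. i \<in> I \<Longrightarrow> j \<in> I \<Longrightarrow> \<exists>k\<in>I. F k \<subseteq> F i \<inter> F j"
  shows "C \<inter> (\<Inter>i\<in>I. F i) \<noteq> {}"
proof
  assume "C \<inter> (\<Inter>i\<in>I. F i) = {}"
  then have "C \<subseteq> (\<Union>i\<in>I. - F i)"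
    by blast
  moreover have "open (- F i)" if "i \<in> I" for i
    using closed that by blast
  ultimately obtain J where J: "J \<subseteq> I" "finite J" "C \<subseteq> (\<Union>i\<in>J. - F i)"
    using compactE_image[OF C, of I "\<lambda>i. - F i"] by metis
  from J(2,1) have "\<exists>k\<in>I. F k \<subseteq> (\<Inter>i\<in>J. F i)"
  proof (induction J rule: finite_induct)
    case empty
    then show ?case using \<open>I \<noteq> {}\<close> by auto
  next
    case (insert j J)
    then obtain k where "k \<in> I" "F k \<subseteq> (\<Inter>i\<in>J. F i)"
      by auto
    moreover obtain l where "l \<in> I" "F l \<subseteq> F k \<inter> F j"
      using directed[of k j] \<open>k \<in> I\<close> insert.prems by auto
    ultimately show ?case by auto
  qed
  then obtain k where "k \<in> I" "F k \<subseteq> (\<Inter>i\<in>J. F i)"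
    by blast
  then have "C \<inter> F k = {}"
    using J(3) by blast
  then show False
    using meets \<open>k \<in> I\<close> by blast
qed

lemma locally_compact_regular_shrink:
  fixes V :: "'x::topological_space set"
  assumes reg: "regular_space (euclidean :: 'x topology)"
    and lc: "locally_compact_space (euclidean :: 'x topology)"
    and "compact C" "open V" "C \<subseteq> V"
  obtains G where "open G" "C \<subseteq> G" "compact (closure G)" "closure G \<subseteq> V"
proof -
  obtain U L where L: "open U" "compact L" "closed L" "C \<subseteq> U" "U \<subseteq> L"
    using lc \<open>compact C\<close> reg locally_compact_space_compact_closed_compact[of "euclidean :: 'x topology"]
    by (metis compactin_euclidean_iff open_openin closed_closedin)
  have "disjnt C (- V)"
    using \<open>C \<subseteq> V\<close> by (auto simp: disjnt_def)
  then obtain U' W where W: "open U'" "open W" "C \<subseteq> U'" "- V \<subseteq> W" "disjnt U' W"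
    using regular_space_compact_closed_separation[OF reg, of C "- V"] \<open>compact C\<close> \<open>open V\<close>
    by (auto simp: closed_Compl)
  have "closure (U \<inter> U') \<subseteq> L \<inter> - W"
    using L W by (intro closure_minimal closed_Int closed_Compl) (auto simp: disjnt_def)
  moreover have "compact (closure (U \<inter> U'))"
    using calculation compact_Int_closed[OF \<open>compact L\<close>, of "closure (U \<inter> U')"]
    by (simp add: inf.absorb2)
  ultimately show thesis
    using L W by (intro that[of "U \<inter> U'"]) auto
qed

lemma act_set_singleton: "act_set act A {x} = (\<lambda>s. act s x) ` A"
  by (auto simp: act_set_def)

lemma act_set_mono: "Y \<subseteq> Z \<Longrightarrow> act_set act A Y \<subseteq> act_set act A Z"
  by (auto simp: act_set_def)

text \<open>Half-refinement applied to a set and itself turns into containment of stars.\<close>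

lemma St_half_refines:
  assumes "half_refines \<W> \<U>"
  shows "St x \<W> \<subseteq> St x \<U>"
proof
  fix y assume "y \<in> St x \<W>"
  then obtain W where W: "W \<in> \<W>" "x \<in> W" "y \<in> W"
    by (auto simp: St_def)
  then have "W \<inter> W \<noteq> {}"
    by auto
  then obtain U where "U \<in> \<U>" "W \<union> W \<subseteq> U"
    using assms W(1) unfolding half_refines_def by meson
  then show "y \<in> St x \<U>"
    using W by (auto simp: St_def)
qed

lemma admissible_stars_directed:
  assumes "admissible \<O>" "\<U> \<in> \<O>" "\<V> \<in> \<O>"
  obtains \<W> where "\<W> \<in> \<O>" "St x \<W> \<subseteq> St x \<U> \<inter> St x \<V>"
proof -
  obtain \<W> where "\<W> \<in> \<O>" "half_refines \<W> \<U>" "half_refines \<W> \<V>"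
    using assms unfolding admissible_def by meson
  then show thesis
    using that[of \<W>] St_half_refines by (metis le_infI)
qed

lemma admissible_open_covering: "admissible \<O> \<Longrightarrow> \<U> \<in> \<O> \<Longrightarrow> open_covering \<U>"
  by (auto simp: admissible_def)

lemma admissible_star_subset:
  assumes "admissible \<O>" "open G" "x \<in> G"
  obtains \<U> where "\<U> \<in> \<O>" "St x \<U> \<subseteq> G"
  using assms unfolding admissible_def by meson

lemma semigroup_action_continuous_left:
  assumes "semigroup_action act"
  shows "continuous_on UNIV (\<lambda>s. act s y)"
proof -
  have "continuous_on UNIV (\<lambda>s. case (s, y) of (s, x) \<Rightarrow> act s x)"
    by (rule continuous_on_compose2[where t = UNIV])
      (use assms in \<open>auto simp: semigroup_action_def intro!: continuous_intros\<close>)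
  then show ?thesis
    by simp
qed

lemma semigroup_action_continuous_right:
  assumes "semigroup_action act"
  shows "continuous_on UNIV (act s)"
proof -
  have "continuous_on UNIV (\<lambda>x. case (s, x) of (s, x) \<Rightarrow> act s x)"
    by (rule continuous_on_compose2[where t = UNIV])
      (use assms in \<open>auto simp: semigroup_action_def intro!: continuous_intros\<close>)
  then show ?thesis
    by simp
qed

lemma K_subset_D:
  assumes "admissible \<O>"
  shows "K act A x \<subseteq> D act \<O> A x"
  unfolding K_def D_def
proof (intro INT_greatest closure_mono act_set_mono)
  fix \<U> assume "\<U> \<in> \<O>"
  then show "{x} \<subseteq> St x \<U>"
    using mem_St[OF admissible_open_covering[OF assms]] by simp
qed

lemma D_subset_K_if_upper_semicontinuous:
  fixes act :: "'s \<Rightarrow> 'x::topological_space \<Rightarrow> 'x"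
  assumes reg: "regular_space (euclidean :: 'x topology)"
    and adm: "admissible \<O>"
    and usc: "upper_semicontinuous_at (K act A) x"
  shows "D act \<O> A x \<subseteq> K act A x"
proof (rule subsetI, rule ccontr)
  fix z assume z: "z \<in> D act \<O> A x" "z \<notin> K act A x"
  have "closed (K act A x)"
    by (simp add: K_def)
  then obtain W V where WV: "open W" "open V" "z \<in> W" "K act A x \<subseteq> V" "disjnt W V"
    using reg z(2) unfolding regular_space_def
    by (metis DiffI UNIV_I closed_closedin open_openin topspace_euclidean)
  then obtain N where "open N" "x \<in> N" and N: "\<And>y. y \<in> N \<Longrightarrow> K act A y \<subseteq> V"
    using usc unfolding upper_semicontinuous_at_def eventually_nhds by metis
  then obtain \<U> where \<U>: "\<U> \<in> \<O>" "St x \<U> \<subseteq> N"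
    using admissible_star_subset[OF adm] by metis
  have "act s y \<in> V" if "s \<in> A" "y \<in> St x \<U>" for s y
  proof -
    have "act s y \<in> K act A y"
      unfolding K_def using that(1) by (intro subsetD[OF closure_subset]) (auto simp: act_set_def)
    then show ?thesis
      using N \<U>(2) that(2) by blast
  qed
  then have "closure (act_set act A (St x \<U>)) \<subseteq> - W"
    using WV by (intro closure_minimal closed_Compl) (auto simp: act_set_def disjnt_def)
  then show False
    using z(1) \<U>(1) WV(3) unfolding D_def by blast
qed

text \<open>
  Connectedness of \<open>A\<close> is what makes compactness applicable: an orbit that leaves \<open>G\<close> may escape
  far away, but if it also meets \<open>G\<close> then it leaves a trace on the compact frontier of \<open>G\<close>.
\<close>

lemma star_orbits_subset_open:
  fixes act :: "'s::topological_semigroup_mult \<Rightarrow> 'x::topological_space \<Rightarrow> 'x"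
  assumes adm: "admissible \<O>" and act: "semigroup_action act"
    and A: "connected A" "A \<noteq> {}"
    and G: "open G" "compact (closure G)"
    and DG: "D act \<O> A x \<subseteq> G"
  obtains \<U> where "\<U> \<in> \<O>" "act_set act A (St x \<U>) \<subseteq> G"
proof (rule ccontr)
  assume "\<not> thesis"
  then have escape: "\<not> act_set act A (St x \<U>) \<subseteq> G" if "\<U> \<in> \<O>" for \<U>
    using that \<open>\<And>\<U>. \<U> \<in> \<O> \<Longrightarrow> act_set act A (St x \<U>) \<subseteq> G \<Longrightarrow> thesis\<close> by blast
  obtain a where a: "a \<in> A"
    using A(2) by blast
  have KG: "K act A x \<subseteq> G"
    using K_subset_D[OF adm] DG by blast
  have "open (act a -` G)"
    using semigroup_action_continuous_right[OF act] G(1) by (simp add: continuous_on_open_vimage)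
  moreover have "act a x \<in> K act A x"
    unfolding K_def using a by (intro subsetD[OF closure_subset]) (auto simp: act_set_def)
  then have "x \<in> act a -` G"
    using KG by auto
  ultimately obtain \<V> where \<V>: "\<V> \<in> \<O>" "St x \<V> \<subseteq> act a -` G"
    using admissible_star_subset[OF adm] by metis
  let ?F = "\<lambda>\<U>. closure (act_set act A (St x \<U>))"
  have "frontier G \<inter> ?F \<U> \<noteq> {}" if \<U>: "\<U> \<in> \<O>" for \<U>
  proof -
    \<comment> \<open>Inside \<open>St x \<V>\<close> every orbit meets \<open>G\<close>, so the orbit leaving \<open>G\<close> is taken from there.\<close>
    obtain \<W> where \<W>: "\<W> \<in> \<O>" "St x \<W> \<subseteq> St x \<U> \<inter> St x \<V>"
      using admissible_stars_directed[OF adm \<U> \<V>(1)] .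
    obtain y s where y: "y \<in> St x \<W>" and s: "s \<in> A" "act s y \<notin> G"
      using escape[OF \<W>(1)] unfolding act_set_def by blast
    have "connected (act_set act A {y})"
      unfolding act_set_singleton
      using continuous_on_subset[OF semigroup_action_continuous_left[OF act]] A(1)
      by (intro connected_continuous_image) auto
    moreover have "act_set act A {y} \<inter> G \<noteq> {}"
      using a y \<W>(2) \<V>(2) unfolding act_set_singleton by blast
    moreover have "act_set act A {y} - G \<noteq> {}"
      using s by (auto simp: act_set_singleton)
    ultimately have "act_set act A {y} \<inter> frontier G \<noteq> {}"
      by (rule connected_Int_frontier)
    moreover have "act_set act A {y} \<subseteq> ?F \<U>"
      using act_set_mono[of "{y}" "St x \<U>"] y \<W>(2) closure_subset by blast
    ultimately show ?thesis
      by blast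
  qed
  moreover have "compact (frontier G)"
    using G(2) compact_Int_closed[OF G(2), of "- interior G"]
    by (simp add: frontier_def Diff_eq closed_Compl)
  moreover have "\<exists>\<W>\<in>\<O>. ?F \<W> \<subseteq> ?F \<U> \<inter> ?F \<U>'" if \<U>: "\<U> \<in> \<O>" "\<U>' \<in> \<O>" for \<U> \<U>'
  proof -
    obtain \<W> where "\<W> \<in> \<O>" "St x \<W> \<subseteq> St x \<U> \<inter> St x \<U>'"
      using admissible_stars_directed[OF adm \<U>] .
    then show ?thesis
      by (metis Int_subset_iff act_set_mono closure_mono)
  qed
  ultimately have "frontier G \<inter> (\<Inter>\<U>\<in>\<O>. ?F \<U>) \<noteq> {}"
    using \<V>(1) by (intro compact_Int_directed_closed) auto
  moreover have "frontier G \<inter> G = {}"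
    using G(1) by (simp add: frontier_def interior_open Diff_Int_distrib2)
  ultimately show False
    using DG unfolding D_def by blast
qed

lemma upper_semicontinuous_if_D_subset_K:
  fixes act :: "'s::topological_semigroup_mult \<Rightarrow> 'x::topological_space \<Rightarrow> 'x"
  assumes reg: "regular_space (euclidean :: 'x topology)"
    and lc: "locally_compact_space (euclidean :: 'x topology)"
    and adm: "admissible \<O>" and act: "semigroup_action act"
    and A: "connected A" "A \<noteq> {}"
    and K: "compact (K act A x)"
    and DK: "D act \<O> A x \<subseteq> K act A x"
  shows "upper_semicontinuous_at (K act A) x"
  unfolding upper_semicontinuous_at_def
proof (intro allI impI)
  fix V assume "open V" "K act A x \<subseteq> V"
  then obtain G where G: "open G" "K act A x \<subseteq> G" "compact (closure G)" "closure G \<subseteq> V"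
    using locally_compact_regular_shrink[OF reg lc K] by metis
  obtain \<U> where \<U>: "\<U> \<in> \<O>" "act_set act A (St x \<U>) \<subseteq> G"
    using star_orbits_subset_open[OF adm act A G(1,3)] DK G(2) by blast
  have "K act A y \<subseteq> V" if "y \<in> St x \<U>" for y
  proof -
    have "act_set act A {y} \<subseteq> G"
      using act_set_mono[of "{y}" "St x \<U>"] that \<U>(2) by blast
    then show ?thesis
      unfolding K_def using closure_mono G(4) by blast
  qed
  moreover have "open (St x \<U>)" "x \<in> St x \<U>"
    using admissible_open_covering[OF adm \<U>(1)] by (simp_all add: open_St mem_St)
  ultimately show "\<forall>\<^sub>F y in nhds x. K act A y \<subseteq> V"
    unfolding eventually_nhds by blast
qed

theorem proposition15:
  fixes act :: "'s::topological_semigroup_mult \<Rightarrow> 'x::topological_space \<Rightarrow> 'x"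
    and \<O> :: "'x set set set"
    and A :: "'s set"
    and x :: 'x
  assumes "completely_regular_space (euclidean :: 'x topology)"
    and "admissible \<O>"
    and "semigroup_action act"
    and "\<And>y. K act A y \<noteq> {} \<and> compact (K act A y)"
    and "\<And>y. D act \<O> A y \<noteq> {} \<and> compact (D act \<O> A y)"
  shows "(upper_semicontinuous_at (K act A) x \<longrightarrow> K act A x = D act \<O> A x) \<and>
    (Hausdorff_space (euclidean :: 'x topology) \<and> locally_compact_space (euclidean :: 'x topology)
       \<and> connected A \<longrightarrow>
     K act A x = D act \<O> A x \<longrightarrow> upper_semicontinuous_at (K act A) x)"
proof -
  have reg: "regular_space (euclidean :: 'x topology)"
    using assms(1) by (rule completely_regular_imp_regular_space)
  have "A \<noteq> {}"
    using assms(4)[of x] by (auto simp: K_def act_set_def)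
  show ?thesis
  proof (intro conjI impI; (elim conjE)?)
    assume "upper_semicontinuous_at (K act A) x"
    then show "K act A x = D act \<O> A x"
      by (intro subset_antisym K_subset_D[OF assms(2)]
          D_subset_K_if_upper_semicontinuous[OF reg assms(2)])
  next
    assume "locally_compact_space (euclidean :: 'x topology)" "connected A"
      and "K act A x = D act \<O> A x"
    then show "upper_semicontinuous_at (K act A) x"
      using upper_semicontinuous_if_D_subset_K[OF reg _ assms(2,3) _ \<open>A \<noteq> {}\<close>] assms(4)
      by simp
  qed
qed

end
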